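(* Let $y_1,\dots,y_n\in\mathbb{R}$, let $\hat y_{j,-i}=\hat y_{j,-i}(x_i)\in\mathbb{R}$ for $j=1,\dots,J$, $i=1,\dots,n$, and let $m\in\mathbb{R}$, $m\neq 0$. Let $U=(u_{lj})$ be the $J\times J$ matrix with entries $$u_{lj}=\sum_{i=1}^n\Big(\frac{y_i}{m}-\hat y_{j,-i}\Big)\hat y_{l,-i}-\sum_{i=1}^n\big(y_i-\hat y_{j,-i}\big)y_i ,$$ assumed invertible, and let $1_J=(1,\dots,1)'\in\mathbb{R}^J$. Then the weights $\hat w=(\hat w_1,\dots,\hat w_J)'$ achieving $$\min_{w\in\mathbb{R}^J}\ \sum_{i=1}^n\Big(y_i-\sum_{j=1}^J w_j\hat y_{j,-i}(x_i)\Big)^2\quad\text{subject to}\quad\sum_{j=1}^J w_j=m$$ are of the form $$\hat w\propto U^{-1}1_J .$$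
   Context: Here $y_i$ is the observed response at design point $x_i$ and $\hat y_{j,-i}(x_i)$ is the prediction at $x_i$ from the $j$-th of $J$ predictors fitted without the $i$-th data point; for the statement these are arbitrary given real numbers. No sign constraint is imposed on the weights. $\propto$ means equal up to a scalar factor (determined by the constraint $\sum_j w_j=m$). *)

theory Defs
  imports "HOL-Analysis.Analysis"
begin

text \<open>Encoding of the data: \<open>y $ i\<close> is the \<open>i\<close>-th response, and \<open>yhat $ j $ i\<close> is the prediction
  at the \<open>i\<close>-th design point from the \<open>j\<close>-th predictor fitted without the \<open>i\<close>-th data point.\<close>

definition stacking_objective ::
  "real ^ 'n \<Rightarrow> real ^ 'n ^ 'j \<Rightarrow> real ^ 'j \<Rightarrow> real" where
  "stacking_objective y yhat w =
     (\<Sum>i\<in>UNIV. (y $ i - (\<Sum>j\<in>UNIV. w $ j * yhat $ j $ i))\<^sup>2)"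

text \<open>In \<open>\<chi> l j\<close> below, \<open>l\<close> is the row index and \<open>j\<close> the column index.\<close>

definition stacking_matrix ::
  "real ^ 'n \<Rightarrow> real ^ 'n ^ 'j \<Rightarrow> real \<Rightarrow> real ^ 'j ^ 'j" where
  "stacking_matrix y yhat m =
     (\<chi> l j. (\<Sum>i\<in>UNIV. (y $ i / m - yhat $ j $ i) * yhat $ l $ i)
            - (\<Sum>i\<in>UNIV. (y $ i - yhat $ j $ i) * y $ i))"

end

theory Submission
  imports Defs
begin

text \<open>The objective is the squared distance from \<open>y\<close> to the combination \<open>w v* yhat\<close> of the
  predictors, and the combinations with weights summing to \<open>m\<close> form an affine, hence closed and
  convex, set; so a nearest point exists. At a nearest point the residual has the same inner
  product with every predictor, because moving weight from one predictor to another keeps the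
  constraint. Since \<open>y / m\<close> weighted by \<open>w\<close> sums to \<open>y\<close>, this says that all entries
  of \<open>U w\<close> coincide.\<close>

lemma stacking_objective_eq_dist:
  "stacking_objective y yhat w = (dist y (w v* yhat))\<^sup>2"
  unfolding stacking_objective_def dist_norm power2_norm_eq_inner
  by (simp add: inner_vec_def vector_matrix_mult_def power2_eq_square mult.commute)

lemma axis_vector_matrix_mult:
  fixes A :: "real ^ 'n ^ 'j"
  shows "axis l 1 v* A = A $ l"
  by (simp add: vec_eq_iff vector_matrix_mult_def axis_def if_distrib[of "\<lambda>x. x * _"]
      cong: if_cong)

lemma affine_weight_sum:
  "affine {w :: real ^ 'j. (\<Sum>j\<in>UNIV. w $ j) = m}"
  by (auto simp: affine_def sum.distrib simp flip: sum_distrib_left distrib_right)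

text \<open>Linear maps preserve affine sets. Affinity gives both properties used below: convexity,
  and closedness, since affine sets in finite dimension are closed.\<close>

lemma affine_weighted_combinations:
  fixes yhat :: "real ^ 'n ^ 'j"
  shows "affine ((\<lambda>w. w v* yhat) ` {w. (\<Sum>j\<in>UNIV. w $ j) = m})"
proof -
  have "linear (\<lambda>w. w v* yhat)"
    using matrix_vector_mul_linear[of "transpose yhat"] by simp
  then show ?thesis
    by (metis affine_hull_eq affine_hull_linear_image affine_weight_sum linear_conv_bounded_linear)
qed

lemma weight_sum_nonempty:
  "{w :: real ^ 'j. (\<Sum>j\<in>UNIV. w $ j) = m} \<noteq> {}"
proof -
  \<comment> \<open>All of the weight \<open>m\<close> is put on one arbitrary predictor.\<close>
  have "(\<Sum>j\<in>UNIV. axis (undefined :: 'j) m $ j) = m"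
    by (simp add: axis_def)
  then show ?thesis by blast
qed

lemma is_arg_min_stacking_objective_iff:
  "is_arg_min (stacking_objective y yhat) P w \<longleftrightarrow>
    P w \<and> (\<forall>v. P v \<longrightarrow> dist y (w v* yhat) \<le> dist y (v v* yhat))"
  by (auto simp: is_arg_min_linorder stacking_objective_eq_dist)

text \<open>The minimum is sought among the combinations, not the weights: different weights may
  give the same combination, and any preimage of a nearest point will do.\<close>

lemma stacking_minimizer_exists:
  fixes yhat :: "real ^ 'n ^ 'j"
  shows "\<exists>w. is_arg_min (stacking_objective y yhat) (\<lambda>w. (\<Sum>j\<in>UNIV. w $ j) = m) w"
proof -
  let ?S = "{w :: real ^ 'j. (\<Sum>j\<in>UNIV. w $ j) = m}"
  let ?T = "(\<lambda>w. w v* yhat) ` ?S"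
  have "closed ?T"
    by (intro affine_closed affine_weighted_combinations)
  moreover have "?T \<noteq> {}"
    using weight_sum_nonempty by blast
  ultimately obtain p where "p \<in> ?T" "\<forall>q\<in>?T. dist y p \<le> dist y q"
    using distance_attains_inf by metis
  then show ?thesis
    by (auto simp: is_arg_min_stacking_objective_iff)
qed

text \<open>The residual at a nearest point of a closed convex set has inner product at most 0 with
  every direction leading to another point of the set. The directions for \<open>l\<close>,
  \<open>k\<close> and for \<open>k\<close>, \<open>l\<close> are opposite, so equality
  follows.\<close>

lemma stacking_minimizer_residual_inner:
  fixes yhat :: "real ^ 'n ^ 'j"
  assumes "is_arg_min (stacking_objective y yhat) (\<lambda>w. (\<Sum>j\<in>UNIV. w $ j) = m) w"
  shows "(y - w v* yhat) \<bullet> yhat $ l = (y - w v* yhat) \<bullet> yhat $ k"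
proof -
  let ?S = "{w :: real ^ 'j. (\<Sum>j\<in>UNIV. w $ j) = m}"
  let ?T = "(\<lambda>w. w v* yhat) ` ?S"
  have w: "w \<in> ?S" and min: "\<forall>q\<in>?T. dist y (w v* yhat) \<le> dist y q"
    using assms by (auto simp: is_arg_min_stacking_objective_iff)
  have "(y - w v* yhat) \<bullet> (yhat $ l - yhat $ k) \<le> 0" for l k
  proof -
    \<comment> \<open>One unit of weight moves from predictor \<open>k\<close> to predictor
      \<open>l\<close>.\<close>
    let ?v = "w + axis l 1 - axis k 1"
    have "?v \<in> ?S"
      using w by (simp add: sum.distrib sum_subtractf axis_def)
    moreover have "?v v* yhat - w v* yhat = yhat $ l - yhat $ k"
      by (simp add: algebra_simps axis_vector_matrix_mult)
    ultimately show ?thesis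
      using any_closest_point_dot[of ?T "w v* yhat" "?v v* yhat" y] w min
        affine_weighted_combinations[of yhat m]
      by (simp add: affine_imp_convex affine_closed)
  qed
  from this[of l k] this[of k l] show ?thesis
    by (simp add: inner_diff_right)
qed

text \<open>The constraint turns the weighted sum of \<open>y / m\<close> into \<open>y\<close> and
  that of \<open>y\<close> into \<open>m *\<^sub>R y\<close>. The subtracted inner product is free
  of \<open>l\<close>, so entries of the product differ only through the residual term.\<close>

lemma stacking_matrix_mult_nth:
  fixes yhat :: "real ^ 'n ^ 'j"
  assumes "m \<noteq> 0" and "(\<Sum>j\<in>UNIV. w $ j) = m"
  shows "(stacking_matrix y yhat m *v w) $ l =
    (y - w v* yhat) \<bullet> yhat $ l - (m *\<^sub>R y - w v* yhat) \<bullet> y"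
proof -
  have comb: "w v* yhat = (\<Sum>j\<in>UNIV. w $ j *\<^sub>R yhat $ j)"
    by (simp add: vec_eq_iff vector_matrix_mult_def mult.commute)
  have y: "y = (\<Sum>j\<in>UNIV. w $ j *\<^sub>R (y /\<^sub>R m))"
    using assms by (simp flip: scaleR_left.sum sum_distrib_right)
  have my: "m *\<^sub>R y = (\<Sum>j\<in>UNIV. w $ j *\<^sub>R y)"
    using assms by (simp flip: scaleR_left.sum)
  have "(stacking_matrix y yhat m *v w) $ l =
    (\<Sum>j\<in>UNIV. w $ j * ((y /\<^sub>R m - yhat $ j) \<bullet> yhat $ l - (y - yhat $ j) \<bullet> y))"
    by (simp add: stacking_matrix_def matrix_vector_mult_def inner_vec_def divide_inverse
        mult.commute)
  also have "\<dots> = ((\<Sum>j\<in>UNIV. w $ j *\<^sub>R (y /\<^sub>R m)) - w v* yhat) \<bullet> yhat $ l -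
      ((\<Sum>j\<in>UNIV. w $ j *\<^sub>R y) - w v* yhat) \<bullet> y"
    unfolding comb
    by (simp only: inner_sum_left inner_scaleR_left right_diff_distrib scaleR_diff_right
        flip: sum_subtractf)
      (simp add: algebra_simps)
  finally show ?thesis
    by (simp only: flip: y my)
qed

lemma invertible_matrix_inv_left:
  assumes "invertible A"
  shows "matrix_inv A ** A = mat 1"
  using someI_ex[OF assms[unfolded invertible_def]] by (simp add: matrix_inv_def)

theorem theorem3p1:
  fixes y :: "real ^ 'n" and yhat :: "real ^ 'n ^ 'j" and m :: real
  assumes "m \<noteq> 0"
    and "invertible (stacking_matrix y yhat m)"
  shows "(\<exists>w. is_arg_min (stacking_objective y yhat) (\<lambda>w. (\<Sum>j\<in>UNIV. w $ j) = m) w) \<and>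
    (\<forall>w. is_arg_min (stacking_objective y yhat) (\<lambda>w. (\<Sum>j\<in>UNIV. w $ j) = m) w \<longrightarrow>
      (\<exists>c. w = c *\<^sub>R (matrix_inv (stacking_matrix y yhat m) *v vec 1)))"
proof (intro conjI allI impI)
  show "\<exists>w. is_arg_min (stacking_objective y yhat) (\<lambda>w. (\<Sum>j\<in>UNIV. w $ j) = m) w"
    by (rule stacking_minimizer_exists)
next
  fix w
  assume min: "is_arg_min (stacking_objective y yhat) (\<lambda>w. (\<Sum>j\<in>UNIV. w $ j) = m) w"
  let ?U = "stacking_matrix y yhat m"
  have sum: "(\<Sum>j\<in>UNIV. w $ j) = m"
    using min by (simp add: is_arg_min_def)
  \<comment> \<open>All entries of \<open>?U *v w\<close> will turn out equal, so the one at an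
    arbitrary index serves as their common value.\<close>
  define c where "c = (?U *v w) $ undefined"
  have "(?U *v w) $ l = c" for l
    using stacking_minimizer_residual_inner[OF min, of l undefined]
    by (simp add: c_def stacking_matrix_mult_nth[OF assms(1) sum])
  then have "?U *v w = c *\<^sub>R vec 1"
    by (simp add: vec_eq_iff)
  moreover have "w = matrix_inv ?U *v (?U *v w)"
    using assms(2) by (simp add: matrix_vector_mul_assoc invertible_matrix_inv_left)
  ultimately show "\<exists>c. w = c *\<^sub>R (matrix_inv ?U *v vec 1)"
    by (metis matrix_vector_mult_scaleR)
qed

end
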